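(* Suppose the number $m$ of alternatives is at least $3$. Then for every $0\le\varepsilon_v<1$ and $0<\delta<1/2$ there exists an $(\varepsilon_v,0,\delta,\text{single peaked})$-Random Outliers vs Random Profile Tester with sample complexity $O\left(\frac{1}{(1-\varepsilon_v)^2}\log\frac{1}{\delta}\right)$. If there are only $2$ alternatives, then there does not exist any such tester.
   Context: Profiles. Let $\mathcal{A}$ be a finite set of $m$ alternatives and $\mathcal{L}(\mathcal{A})$ the set of linear orders (preferences) over $\mathcal{A}$. A profile is a tuple $(\succ_i)_{i\in[n]}$ of $n$ preferences over $\mathcal{A}$, one per agent. A profile is single peaked if there is a linear order (societal axis) on $\mathcal{A}$ such that, for every preference $\succ$ in the profile with most preferred alternative $t$, whenever $x$ lies between $t$ and $y$ on the axis (with $x\ne y$), we have $x\succ y$. Sampling model. An oracle, when queried, returns an agent picked uniformly at random with replacement from the set of all $n$ agents. The algorithm may then ask this agent arbitrarily many comparison queries: given two alternatives $x,y$, the agent replies which of the two it prefers. The sample complexity of an algorithm is the total number of comparison queries it makes. Problem. An $(\varepsilon_v,0,\delta,\text{single peaked})$-Random Outliers vs Random Profile Tester is a (randomized) algorithm in this model which, given a profile $(\succ_i)_{i\in[n]}$ over $\mathcal{A}$ that is of one of the following two kinds, outputs $1$ if it is of kind (i) and $0$ if it is of kind (ii), with error probability at most $\delta$: (i) there exists $\mathcal{W}\subseteq[n]$ with $|\mathcal{W}|\ge(1-\varepsilon_v)n$ such that $(\succ_i)_{i\in\mathcal{W}}$ is single peaked, and for every $j\in[n]\setminus\mathcal{W}$,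 $\succ_j$ is distributed (independently) uniformly in $\mathcal{L}(\mathcal{A})$; (ii) for every $i\in[n]$, $\succ_i$ is distributed (independently) uniformly in $\mathcal{L}(\mathcal{A})$. The error probability is over the randomness generating the instance and the randomness of the algorithm (including the oracle).
   Formalization: The existence claim is proved for numbers of agents n at least C·log(1/δ)/(1-ε_v)², with the same absolute constant C as in the sample complexity; without a lower bound on n it fails (for n = 1 every profile is single peaked). *)

theory Defs
  imports "HOL-Probability.Probability"
begin

section \<open>Preferences and single peaked profiles\<close>

text \<open>
  A preference is a reflexive linear order \<open>r\<close> on the alternatives, where \<open>(x, y) \<in> r\<close> reads
  ``\<open>x\<close> is weakly preferred to \<open>y\<close>'': the most preferred alternative is the first one.
\<close>

type_synonym 'a profile = "nat \<Rightarrow> ('a \<times> 'a) set"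

definition linear_orders :: "'a set \<Rightarrow> ('a \<times> 'a) set set" where
  "linear_orders A = {r. linear_order_on A r}"

definition most_preferred :: "'a set \<Rightarrow> ('a \<times> 'a) set \<Rightarrow> 'a \<Rightarrow> bool" where
  "most_preferred A r t \<longleftrightarrow> t \<in> A \<and> (\<forall>x\<in>A. (t, x) \<in> r)"

definition between :: "('a \<times> 'a) set \<Rightarrow> 'a \<Rightarrow> 'a \<Rightarrow> 'a \<Rightarrow> bool" where
  "between ax t x y \<longleftrightarrow> (t, x) \<in> ax \<and> (x, y) \<in> ax \<or> (y, x) \<in> ax \<and> (x, t) \<in> ax"

definition single_peaked :: "'a set \<Rightarrow> nat set \<Rightarrow> 'a profile \<Rightarrow> bool" where
  "single_peaked A W P \<longleftrightarrow>
     (\<exists>ax \<in> linear_orders A. \<forall>i\<in>W. \<forall>t. most_preferred A (P i) t \<longrightarrow>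
        (\<forall>x\<in>A. \<forall>y\<in>A. x \<noteq> y \<and> between ax t x y \<longrightarrow> (x, y) \<in> P i))"


section \<open>The sampling model\<close>

text \<open>
  A randomized adaptive algorithm. \<open>Draw\<close> queries the oracle and learns the name of the returned
  agent; \<open>Compare x y\<close> asks the agent drawn last whether it prefers \<open>x\<close> to \<open>y\<close>; \<open>Randomize\<close> is an
  internal random choice; \<open>Output True\<close> and \<open>Output False\<close> are the outputs 1 and 0. The type is
  coinductive so that algorithms that need not terminate on every run are included.
\<close>

codatatype 'a algorithm =
    Output bool
  | Draw "nat \<Rightarrow> 'a algorithm"
  | Compare 'a 'a "bool \<Rightarrow> 'a algorithm"
  | Randomize "'a algorithm pmf"

text \<open>
  The output distribution on a fixed profile of the agents \<open>{..<n}\<close>; the missing probability mass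
  is that of nontermination. The argument \<open>r\<close> is the preference of the agent drawn last.
\<close>

partial_function (spmf) run_from ::
  "nat \<Rightarrow> 'a profile \<Rightarrow> ('a \<times> 'a) set \<Rightarrow> 'a algorithm \<Rightarrow> bool spmf" where
  "run_from n P r T = (case T of
       Output b \<Rightarrow> return_spmf b
     | Draw k \<Rightarrow> bind_spmf (spmf_of_set {..<n}) (\<lambda>i. run_from n P (P i) (k i))
     | Compare x y k \<Rightarrow> run_from n P r (k ((x, y) \<in> r))
     | Randomize p \<Rightarrow> bind_spmf (spmf_of_pmf p) (\<lambda>T'. run_from n P r T'))"

text \<open>
  Before the first draw there is no agent to ask; the initial empty relation answers every
  comparison by \<open>False\<close>, so that such comparisons carry no information.
\<close>

definition run :: "nat \<Rightarrow> 'a profile \<Rightarrow> 'a algorithm \<Rightarrow> bool spmf" where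
  "run n P T = run_from n P {} T"

text \<open>
  \<open>can_compare T q\<close>: some path of \<open>T\<close> has an initial segment with exactly \<open>q\<close> comparison queries.
  All oracle and agent replies are considered, so that the sample complexity is a worst case bound
  on every run on every profile, whatever its number of agents.
\<close>

inductive can_compare :: "'a algorithm \<Rightarrow> nat \<Rightarrow> bool" where
  "can_compare T 0"
| "can_compare (k i) q \<Longrightarrow> can_compare (Draw k) q"
| "can_compare (k b) q \<Longrightarrow> can_compare (Compare x y k) (Suc q)"
| "T \<in> set_pmf p \<Longrightarrow> can_compare T q \<Longrightarrow> can_compare (Randomize p) q"

definition sample_complexity :: "'a algorithm \<Rightarrow> enat" where
  "sample_complexity T = (SUP q \<in> {q. can_compare T q}. enat q)"


section \<open>Random outliers versus random profile\<close>

text \<open>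
  Kind (i): \<open>W\<close> and the preferences \<open>Q\<close> of its members are arbitrary but fixed, the remaining
  preferences are independent and uniform. Outside \<open>{..<n}\<close>, profiles have the dummy value \<open>{}\<close>.
\<close>

definition random_outliers :: "'a set \<Rightarrow> nat \<Rightarrow> real \<Rightarrow> 'a profile pmf \<Rightarrow> bool" where
  "random_outliers A n \<epsilon> D \<longleftrightarrow>
     (\<exists>W Q. W \<subseteq> {..<n} \<and> real (card W) \<ge> (1 - \<epsilon>) * real n \<and>
        (\<forall>i\<in>W. Q i \<in> linear_orders A) \<and> single_peaked A W Q \<and>
        D = Pi_pmf {..<n} {}
              (\<lambda>i. if i \<in> W then return_pmf (Q i) else pmf_of_set (linear_orders A)))"

definition random_profile :: "'a set \<Rightarrow> nat \<Rightarrow> 'a profile pmf" where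
  "random_profile A n = Pi_pmf {..<n} {} (\<lambda>_. pmf_of_set (linear_orders A))"

text \<open>Probability, over the instance and the run, of not producing the output \<open>b\<close>.\<close>

definition error_prob :: "nat \<Rightarrow> 'a profile pmf \<Rightarrow> 'a algorithm \<Rightarrow> bool \<Rightarrow> real" where
  "error_prob n D T b = measure_pmf.prob (bind_pmf D (\<lambda>P. run n P T)) {z. z \<noteq> Some b}"

definition outliers_tester :: "'a set \<Rightarrow> nat \<Rightarrow> real \<Rightarrow> real \<Rightarrow> 'a algorithm \<Rightarrow> bool" where
  "outliers_tester A n \<epsilon> \<delta> T \<longleftrightarrow>
     (\<forall>D. random_outliers A n \<epsilon> D \<longrightarrow> error_prob n D T True \<le> \<delta>) \<and>
     error_prob n (random_profile A n) T False \<le> \<delta>"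

end

theory Submission
  imports Defs
begin

text \<open>
  On a single peaked set of preferences, the one of three alternatives \<open>a, b, c\<close> that is in the middle
  on the axis is ranked last among the three by nobody, whereas under a uniform preference each of them is
  last with probability \<open>1/3\<close>. The tester draws about \<open>288 (1 - \<epsilon>)\<^sup>-\<^sup>2 ln (1/\<delta>)\<close> agents, finds the last of
  the three for each by two comparisons, and accepts if some alternative is last unusually rarely.
  With two alternatives every profile is single peaked, so a random profile is a mixture of
  instances of kind (i) and a tester would have to give both outputs on it.
\<close>

section \<open>Preferences\<close>

text \<open>Written as the decision tree of two comparisons that the tester performs on a drawn
  agent, so that a run of \<open>sampler\<close> evaluates to it directly.\<close>

definition worst_of :: "'a \<Rightarrow> 'a \<Rightarrow> 'a \<Rightarrow> ('a \<times> 'a) set \<Rightarrow> 'a" where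
  "worst_of a b c r = (if (a, b) \<in> r then (if (b, c) \<in> r then c else b)
                       else (if (a, c) \<in> r then c else a))"

lemma linear_ordersD:
  assumes "r \<in> linear_orders A"
  shows "r \<subseteq> A \<times> A" "\<And>x. x \<in> A \<Longrightarrow> (x, x) \<in> r"
    "\<And>x y z. (x, y) \<in> r \<Longrightarrow> (y, z) \<in> r \<Longrightarrow> (x, z) \<in> r"
    "\<And>x y. (x, y) \<in> r \<Longrightarrow> (y, x) \<in> r \<Longrightarrow> x = y"
    "\<And>x y. x \<in> A \<Longrightarrow> y \<in> A \<Longrightarrow> (x, y) \<in> r \<or> (y, x) \<in> r"
proof -
  have r: "r \<subseteq> A \<times> A" "refl_on A r" "trans r" "antisym r" "total_on A r"
    using assms by (simp_all add: linear_orders_def order_on_defs)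
  show "r \<subseteq> A \<times> A" by (rule r(1))
  show refl: "(x, x) \<in> r" if "x \<in> A" for x using refl_onD[OF r(2) that] .
  show "(x, z) \<in> r" if "(x, y) \<in> r" "(y, z) \<in> r" for x y z using transD[OF r(3) that] .
  show "x = y" if "(x, y) \<in> r" "(y, x) \<in> r" for x y using antisymD[OF r(4) that] .
  show "(x, y) \<in> r \<or> (y, x) \<in> r" if "x \<in> A" "y \<in> A" for x y
    using r(5) refl[OF that(1)] that unfolding total_on_def by metis
qed

text \<open>Replaces the decision tree by a description symmetric in \<open>a\<close>,
  \<open>b\<close>, \<open>c\<close>. The tree finds a last element by totality and transitivity,
  and antisymmetry makes it unique.\<close>

lemma worst_of_eq_iff:
  assumes r: "r \<in> linear_orders A" and A: "a \<in> A" "b \<in> A" "c \<in> A"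
  shows "worst_of a b c r = x \<longleftrightarrow> x \<in> {a, b, c} \<and> (\<forall>y\<in>{a, b, c}. (y, x) \<in> r)"
proof -
  note L = linear_ordersD[OF r]
  have refl: "(a, a) \<in> r" "(b, b) \<in> r" "(c, c) \<in> r" using A L(2) by auto
  have tot: "(a, b) \<in> r \<or> (b, a) \<in> r" "(b, c) \<in> r \<or> (c, b) \<in> r" "(a, c) \<in> r \<or> (c, a) \<in> r"
    using A L(5) by auto
  have "worst_of a b c r \<in> {a, b, c} \<and> (\<forall>y\<in>{a, b, c}. (y, worst_of a b c r) \<in> r)"
    unfolding worst_of_def using refl tot L(3)[of a b c] L(3)[of b a c] by auto
  then show ?thesis using L(4) by blast
qed

section \<open>Uniform preferences and their symmetry under relabelling\<close>

lemma finite_linear_orders: "finite A \<Longrightarrow> finite (linear_orders A)"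
  by (rule finite_subset[of _ "Pow (A \<times> A)"]) (auto dest: linear_ordersD(1))

lemma linear_orders_nonempty: "linear_orders A \<noteq> {}"
  using well_order_on[of A] by (auto simp: linear_orders_def well_order_on_def)

lemma linear_orders_map_prod:
  assumes r: "r \<in> linear_orders A" and f: "bij_betw f A A"
  shows "map_prod f f ` r \<in> linear_orders A"
proof -
  note L = linear_ordersD[OF r]
  have inj: "x = y" if "f x = f y" "x \<in> A" "y \<in> A" for x y
    using f that by (auto simp: bij_betw_def inj_on_def)
  have im: "f ` A = A" using f by (simp add: bij_betw_def)
  have "map_prod f f ` r \<subseteq> A \<times> A" using L(1) im by auto
  moreover have "refl_on A (map_prod f f ` r)"
  proof (rule refl_onI)
    fix y assume "y \<in> A"
    then obtain x where "x \<in> A" "y = f x" using im by blast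
    then show "(y, y) \<in> map_prod f f ` r" using L(2) by force
  qed
  moreover have "trans (map_prod f f ` r)"
  proof (rule transI)
    fix x y z assume "(x, y) \<in> map_prod f f ` r" "(y, z) \<in> map_prod f f ` r"
    then obtain u v v' w where "(u, v) \<in> r" "(v', w) \<in> r" "x = f u" "y = f v" "y = f v'" "z = f w"
      by auto
    \<comment> \<open>\<open>f\<close> is injective on \<open>A\<close> only; this suffices because
      \<open>r\<close> relates only members of \<open>A\<close>.\<close>
    moreover from this have "v = v'" using inj L(1) by blast
    ultimately show "(x, z) \<in> map_prod f f ` r" using L(3) by force
  qed
  moreover have "antisym (map_prod f f ` r)"
  proof (rule antisymI)
    fix x y assume "(x, y) \<in> map_prod f f ` r" "(y, x) \<in> map_prod f f ` r"
    then obtain u v v' w where "(u, v) \<in> r" "(v', w) \<in> r" "x = f u" "y = f v" "y = f v'" "x = f w"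
      by auto
    moreover from this have "v = v'" "u = w" using inj L(1) by blast+
    ultimately show "x = y" using L(4) by force
  qed
  moreover have "total_on A (map_prod f f ` r)"
  proof (rule total_onI)
    fix x y assume "x \<in> A" "y \<in> A"
    then obtain u v where uv: "u \<in> A" "v \<in> A" "x = f u" "y = f v" using im by (metis imageE)
    have "map_prod f f (u, v) \<in> map_prod f f ` r \<or> map_prod f f (v, u) \<in> map_prod f f ` r"
      using L(5)[OF uv(1,2)] by (metis imageI)
    then show "(x, y) \<in> map_prod f f ` r \<or> (y, x) \<in> map_prod f f ` r" using uv by simp
  qed
  ultimately show ?thesis by (simp add: linear_orders_def order_on_defs)
qed

text \<open>Swapping the names \<open>x\<close> and \<open>y\<close> in a preference is injective
  and turns last place of \<open>x\<close> into last place of \<open>y\<close>. Exchanging the roles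
  of \<open>x\<close> and \<open>y\<close> gives equality.\<close>

lemma card_worst_of_le:
  assumes A: "finite A" "{a, b, c} \<subseteq> A" and xy: "x \<in> {a, b, c}" "y \<in> {a, b, c}"
  shows "card {r \<in> linear_orders A. worst_of a b c r = x}
       \<le> card {r \<in> linear_orders A. worst_of a b c r = y}"
proof -
  let ?f = "Transposition.transpose x y"
  let ?F = "\<lambda>r. map_prod ?f ?f ` r"
  have inj: "inj (map_prod ?f ?f)" by (intro prod.inj_map) auto
  then have "inj_on ?F {r \<in> linear_orders A. worst_of a b c r = x}"
    by (intro inj_onI) (metis inj_image_eq_iff)
  moreover have "?F ` {r \<in> linear_orders A. worst_of a b c r = x} \<subseteq> {r \<in> linear_orders A. worst_of a b c r = y}"
  proof (rule image_subsetI)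
    fix r assume "r \<in> {r \<in> linear_orders A. worst_of a b c r = x}"
    then have r: "r \<in> linear_orders A" and w: "worst_of a b c r = x" by auto
    have *: "bij_betw ?f S S" if "x \<in> S" "y \<in> S" for S
      using that by (auto intro!: bij_betw_byWitness[where f'="?f"] simp: Transposition.transpose_def)
    have Fr: "?F r \<in> linear_orders A"
      using * A xy r by (intro linear_orders_map_prod) auto
    have "(z, y) \<in> ?F r" if "z \<in> {a, b, c}" for z
    proof -
      \<comment> \<open>The transposition is an involution preserving the triple, so
        \<open>(z, y)\<close> is the image of \<open>(?f z, x)\<close>.\<close>
      have "?f z \<in> {a, b, c}" using that xy by (auto simp: Transposition.transpose_def)
      then have "(?f z, x) \<in> r" using worst_of_eq_iff[OF r, of a b c x] w A by blast
      then have "map_prod ?f ?f (?f z, x) \<in> ?F r" by (rule imageI)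
      then show ?thesis by simp
    qed
    then have "worst_of a b c (?F r) = y"
      using worst_of_eq_iff[OF Fr, of a b c y] xy A by blast
    with Fr show "?F r \<in> {r \<in> linear_orders A. worst_of a b c r = y}" by simp
  qed
  moreover have "finite {r \<in> linear_orders A. worst_of a b c r = y}"
    using finite_linear_orders[OF A(1)] by simp
  ultimately show ?thesis by (rule card_inj_on_le)
qed

text \<open>By symmetry the three possible last places split the preferences into classes of equal
  size. The Bernoulli form is what the binomial counts below consume.\<close>

lemma worst_of_uniform:
  assumes A: "finite A" "{a, b, c} \<subseteq> A" and dist: "distinct [a, b, c]" and x: "x \<in> {a, b, c}"
  shows "map_pmf (\<lambda>r. worst_of a b c r = x) (pmf_of_set (linear_orders A)) = bernoulli_pmf (1 / 3)"
proof -
  let ?L = "\<lambda>y. {r \<in> linear_orders A. worst_of a b c r = y}"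
  note fin = finite_linear_orders[OF A(1)]
  have eq: "card (?L y) = card (?L x)" if "y \<in> {a, b, c}" for y
    using card_worst_of_le[OF A x that] card_worst_of_le[OF A that x] by simp
  have "linear_orders A = (\<Union>y\<in>{a, b, c}. ?L y)"
    by (auto simp: worst_of_def)
  then have "card (linear_orders A) = card (\<Union>y\<in>{a, b, c}. ?L y)" by simp
  also have "\<dots> = (\<Sum>y\<in>{a, b, c}. card (?L y))"
    by (rule card_UN_disjoint) (use fin in auto)
  also have "\<dots> = 3 * card (?L x)"
    using eq dist by (subst sum.cong[OF refl eq]) auto
  finally have card: "card (linear_orders A) = 3 * card (?L x)" .
  have pos: "0 < card (linear_orders A)"
    using fin linear_orders_nonempty by (simp add: card_gt_0_iff)
  have "linear_orders A \<inter> (\<lambda>r. worst_of a b c r = x) -` {True} = ?L x" by auto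
  then have T: "pmf (map_pmf (\<lambda>r. worst_of a b c r = x) (pmf_of_set (linear_orders A))) True = 1 / 3"
    using card pos
    unfolding pmf_map measure_pmf_of_set[OF linear_orders_nonempty fin] by (simp add: field_simps del: card_0_eq card_gt_0_iff)
  show ?thesis
  proof (rule pmf_eqI)
    fix v :: bool
    show "pmf (map_pmf (\<lambda>r. worst_of a b c r = x) (pmf_of_set (linear_orders A))) v
        = pmf (bernoulli_pmf (1 / 3)) v"
      using T by (cases v) (auto simp: pmf_False_conv_True)
  qed
qed

section \<open>Single peakedness on triples and on two alternatives\<close>

lemma linear_order_middle:
  assumes ax: "ax \<in> linear_orders A" and A: "{a, b, c} \<subseteq> A" and dist: "distinct [a, b, c]"
  obtains u v w where "{u, v, w} = {a, b, c}" "distinct [u, v, w]" "(u, v) \<in> ax" "(v, w) \<in> ax"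
proof -
  note L = linear_ordersD[OF ax]
  have "(a, b) \<in> ax \<or> (b, a) \<in> ax" "(b, c) \<in> ax \<or> (c, b) \<in> ax" "(a, c) \<in> ax \<or> (c, a) \<in> ax"
    using A L(5) by auto
  \<comment> \<open>Each of the eight outcomes of the three comparisons, even a cyclic one, contains
    one of these six chains.\<close>
  then consider "(a, b) \<in> ax" "(b, c) \<in> ax" | "(a, c) \<in> ax" "(c, b) \<in> ax" | "(b, a) \<in> ax" "(a, c) \<in> ax"
    | "(b, c) \<in> ax" "(c, a) \<in> ax" | "(c, a) \<in> ax" "(a, b) \<in> ax" | "(c, b) \<in> ax" "(b, a) \<in> ax"
    by blast
  then show thesis
  proof cases
    case 1 then show ?thesis using dist by (intro that[of a b c]) auto
  next
    case 2 then show ?thesis using dist by (intro that[of a c b]) auto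
  next
    case 3 then show ?thesis using dist by (intro that[of b a c]) auto
  next
    case 4 then show ?thesis using dist by (intro that[of b c a]) auto
  next
    case 5 then show ?thesis using dist by (intro that[of c a b]) auto
  next
    case 6 then show ?thesis using dist by (intro that[of c b a]) auto
  qed
qed

text \<open>\<open>single_peaked\<close> constrains a preference only through its most preferred
  alternative, so one must be exhibited. The induction runs over nonempty subsets of
  \<open>A\<close>.\<close>

lemma most_preferred_exists:
  assumes "finite A" "A \<noteq> {}" "r \<in> linear_orders A"
  obtains t where "most_preferred A r t"
proof -
  note L = linear_ordersD[OF assms(3)]
  have "\<exists>t\<in>S. \<forall>x\<in>S. (t, x) \<in> r" if "finite S" "S \<noteq> {}" "S \<subseteq> A" for S
    using that
  proof (induction rule: finite_ne_induct)
    case (singleton x)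
    then show ?case using L(2) by auto
  next
    case (insert x S)
    then obtain t where t: "t \<in> S" "\<forall>y\<in>S. (t, y) \<in> r" by auto
    have "x \<in> A" "t \<in> A" using t insert by auto
    then have "(t, x) \<in> r \<or> (x, t) \<in> r" "(x, x) \<in> r" using L(2,5) by blast+
    then show ?case
    proof (elim disjE)
      assume "(t, x) \<in> r"
      then show ?case using t by auto
    next
      assume "(x, t) \<in> r"
      then have "\<forall>y\<in>insert x S. (x, y) \<in> r" using t L(3) \<open>(x, x) \<in> r\<close> by blast
      then show ?case by blast
    qed
  qed
  from this[of A] assms show ?thesis using that by (auto simp: most_preferred_def)
qed

text \<open>Let \<open>v\<close> be the middle of the triple on the axis. Wherever the peak lies,
  \<open>v\<close> is between it and the member of the triple on the far side, hence is preferred to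
  that member.\<close>

lemma single_peaked_never_worst:
  assumes A: "finite A" "{a, b, c} \<subseteq> A" and dist: "distinct [a, b, c]"
    and Q: "\<And>i. i \<in> W \<Longrightarrow> Q i \<in> linear_orders A" and sp: "single_peaked A W Q"
  obtains v where "v \<in> {a, b, c}" "\<And>i. i \<in> W \<Longrightarrow> worst_of a b c (Q i) \<noteq> v"
proof -
  obtain ax where ax: "ax \<in> linear_orders A"
    and "\<forall>i\<in>W. \<forall>t. most_preferred A (Q i) t \<longrightarrow>
           (\<forall>x\<in>A. \<forall>y\<in>A. x \<noteq> y \<and> between ax t x y \<longrightarrow> (x, y) \<in> Q i)"
    using sp unfolding single_peaked_def by (elim bexE)
  then have peak: "(x, y) \<in> Q i"
    if "i \<in> W" "most_preferred A (Q i) t" "x \<in> A" "y \<in> A" "x \<noteq> y" "between ax t x y" for i t x y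
    using that by simp
  obtain u v w where uvw: "{u, v, w} = {a, b, c}" "distinct [u, v, w]" "(u, v) \<in> ax" "(v, w) \<in> ax"
    using linear_order_middle[OF ax A(2) dist] .
  have inA: "u \<in> A" "v \<in> A" "w \<in> A" using uvw(1) A(2) by auto
  show thesis
  proof (rule that)
    show "v \<in> {a, b, c}" using uvw(1) by auto
    fix i assume i: "i \<in> W"
    obtain t where t: "most_preferred A (Q i) t"
      using most_preferred_exists[OF A(1) _ Q[OF i]] inA by blast
    then have tA: "t \<in> A" by (simp add: most_preferred_def)
    have "(t, v) \<in> ax \<or> (v, t) \<in> ax" using linear_ordersD(5)[OF ax] tA inA by blast
    \<comment> \<open>A peak before \<open>v\<close> on the axis puts \<open>v\<close> between it
      and \<open>w\<close>; a peak after \<open>v\<close> puts \<open>v\<close> between it and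
      \<open>u\<close>.\<close>
    then have "(v, w) \<in> Q i \<or> (v, u) \<in> Q i"
      using peak[OF i t, of v w] peak[OF i t, of v u] uvw inA by (auto simp: between_def)
    then obtain z where z: "z \<in> {a, b, c}" "(v, z) \<in> Q i" "z \<noteq> v" using uvw(1,2) by auto
    then show "worst_of a b c (Q i) \<noteq> v"
      using worst_of_eq_iff[OF Q[OF i], of a b c v] A(2) linear_ordersD(4)[OF Q[OF i] z(2)] by auto
  qed
qed

lemma single_peaked_card_2:
  assumes A: "card A = 2" and Q: "\<And>i. i \<in> W \<Longrightarrow> Q i \<in> linear_orders A"
  shows "single_peaked A W Q"
proof -
  obtain ax where ax: "ax \<in> linear_orders A" using linear_orders_nonempty by blast
  note L = linear_ordersD[OF ax]
  obtain p q where pq: "A = {p, q}" "p \<noteq> q" using A by (auto simp: card_2_iff)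
  have "(x, y) \<in> Q i"
    if "i \<in> W" "most_preferred A (Q i) t" "x \<in> A" "y \<in> A" "x \<noteq> y" "between ax t x y" for i t x y
  proof -
    \<comment> \<open>If the peak is \<open>x\<close>, it beats \<open>y\<close> by definition. If
      it is \<open>y\<close>, betweenness and antisymmetry of the axis force
      \<open>x = y\<close>.\<close>
    have "t = x \<or> t = y" using that pq by (auto simp: most_preferred_def)
    then show ?thesis
      using that L(4)[of x y] by (auto simp: most_preferred_def between_def)
  qed
  then show ?thesis unfolding single_peaked_def using ax by blast
qed

section \<open>Concentration of resampled counts\<close>

text \<open>On the support \<open>f\<close> is at most \<open>indicator B + c\<close>; integrate
  this.\<close>

lemma integral_le_measure_plus:
  fixes M :: "'a pmf" and f :: "'a \<Rightarrow> real"
  assumes "\<And>x. x \<in> set_pmf M \<Longrightarrow> 0 \<le> f x \<and> f x \<le> 1"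
    and "\<And>x. x \<in> set_pmf M \<Longrightarrow> x \<notin> B \<Longrightarrow> f x \<le> c" and "0 \<le> c"
  shows "measure_pmf.expectation M f \<le> measure_pmf.prob M B + c"
proof -
  have "measure_pmf.expectation M f \<le> measure_pmf.expectation M (\<lambda>x. indicator B x + c)"
  proof (rule integral_mono_AE)
    show "integrable M f"
      by (rule measure_pmf.integrable_const_bound[where B=1])
         (use assms(1) in \<open>auto simp: AE_measure_pmf_iff\<close>)
    show "AE x in M. f x \<le> indicator B x + c"
      using assms by (force simp: AE_measure_pmf_iff indicator_def intro: order_trans)
  qed (auto intro!: measure_pmf.integrable_const_bound[where B="1 + \<bar>c\<bar>"] simp: indicator_def)
  also have "\<dots> = measure_pmf.prob M B + c"
    by (subst Bochner_Integration.integral_add)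
       (auto intro!: measure_pmf.integrable_const_bound[where B=1] simp: indicator_def measure_pmf.prob_space)
  finally show ?thesis .
qed

text \<open>Union bound for a two-stage experiment: either the first stage lands in
  \<open>B\<close>, or the second fails with probability at most \<open>c\<close>. With
  \<open>B = {}\<close> it bounds a mixture by its components.\<close>

lemma measure_bind_pmf_le:
  assumes "\<And>x. x \<in> set_pmf M \<Longrightarrow> x \<notin> B \<Longrightarrow> measure_pmf.prob (f x) S \<le> c" and "0 \<le> c"
  shows "measure_pmf.prob (bind_pmf M f) S \<le> measure_pmf.prob M B + c"
proof -
  have "measure_pmf.prob (bind_pmf M f) S = measure_pmf.expectation M (\<lambda>x. measure_pmf.prob (f x) S)"
    unfolding measure_pmf_bind
    by (rule measure_pmf.measure_bind[where N="count_space UNIV"]) (auto simp: space_subprob_algebra intro!: measure_pmf.subprob_space_axioms)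
  also have "\<dots> \<le> measure_pmf.prob M B + c"
    using assms by (intro integral_le_measure_plus) auto
  finally show ?thesis .
qed

section \<open>Binomial laws of counts and Hoeffding bounds\<close>

lemma count_list_replicate_pmf:
  "map_pmf (\<lambda>ys. count_list ys x) (replicate_pmf k q) = binomial_pmf k (pmf q x)"
proof (induction k)
  case (Suc k)
  \<comment> \<open>One draw contributes a Bernoulli indicator; the first draw is then split off to
    match the recursion of the binomial distribution.\<close>
  have *: "bernoulli_pmf (pmf q x) = map_pmf (\<lambda>y. y = x) q"
  proof (rule pmf_eqI)
    fix b
    have "(\<lambda>y. y = x) -` {True} = {x}" by auto
    then have "pmf (map_pmf (\<lambda>y. y = x) q) True = pmf q x"
      unfolding pmf_map by (simp only: measure_pmf_single)
    then show "pmf (bernoulli_pmf (pmf q x)) b = pmf (map_pmf (\<lambda>y. y = x) q) b"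
      by (cases b) (auto simp: pmf_False_conv_True pmf_le_1)
  qed
  have "map_pmf (\<lambda>ys. count_list ys x) (replicate_pmf (Suc k) q)
      = bind_pmf q (\<lambda>y. bind_pmf (map_pmf (\<lambda>ys. count_list ys x) (replicate_pmf k q))
           (\<lambda>m. return_pmf ((if y = x then 1 else 0) + m)))"
    by (auto simp: map_pmf_def bind_assoc_pmf bind_return_pmf intro!: bind_pmf_cong)
  also have "\<dots> = binomial_pmf (Suc k) (pmf q x)"
    unfolding Suc by (auto simp: binomial_pmf_Suc pmf_le_1 * bind_map_pmf bind_assoc_pmf bind_return_pmf
       intro!: bind_pmf_cong)
  finally show ?case .
qed (simp add: binomial_pmf_0 pmf_le_1)

text \<open>Restricted to \<open>B\<close> and mapped through \<open>f\<close>, the product becomes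
  independent coins. Coordinates outside \<open>B\<close> may have any law, which accommodates the
  fixed preferences of kind (i).\<close>

lemma card_Pi_pmf_binomial:
  assumes "finite I" "B \<subseteq> I" "p \<in> {0..1}" "\<And>i. i \<in> B \<Longrightarrow> map_pmf f (D i) = bernoulli_pmf p"
  shows "map_pmf (\<lambda>P. card {i\<in>B. f (P i)}) (Pi_pmf I d D) = binomial_pmf (card B) p"
proof -
  have B: "finite B" using assms finite_subset by blast
  have "binomial_pmf (card B) p
      = map_pmf (\<lambda>h. card {i\<in>B. h i}) (Pi_pmf B (f d) (\<lambda>_. bernoulli_pmf p))"
    by (intro binomial_pmf_altdef') (use B assms in auto)
  also have "Pi_pmf B (f d) (\<lambda>_. bernoulli_pmf p) = Pi_pmf B (f d) (\<lambda>i. map_pmf f (D i))"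
    using assms by (intro Pi_pmf_cong) auto
  also have "\<dots> = map_pmf (\<lambda>h. f \<circ> h) (Pi_pmf B d D)"
    by (rule Pi_pmf_map) (use B in auto)
  also have "Pi_pmf B d D = map_pmf (\<lambda>P i. if i \<in> B then P i else d) (Pi_pmf I d D)"
    using assms by (intro Pi_pmf_subset) auto
  finally show ?thesis
    by (simp add: map_pmf_comp o_def cong: conj_cong)
qed

text \<open>Hoeffding with deviation measured on the scale \<open>n\<close> instead of the number
  \<open>m\<close> of coins: only the outliers are random, but frequencies refer to all
  agents.\<close>

lemma binomial_tail_ge:
  assumes "p \<in> {0..1}" "0 < m" "m \<le> n" "0 \<le> \<gamma>" "real m * p \<le> real n * q"
  shows "measure_pmf.prob (binomial_pmf m p) {j. real j \<ge> real n * (q + \<gamma>)} \<le> exp (- 2 * real n * \<gamma>\<^sup>2)"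
proof -
  interpret binomial_distribution m p by unfold_locales (rule assms)
  have "measure_pmf.prob (binomial_pmf m p) {j. real j \<ge> real n * (q + \<gamma>)}
      \<le> measure_pmf.prob (binomial_pmf m p) {j. real j \<ge> real m * p + real n * \<gamma>}"
    using assms by (intro measure_pmf.finite_measure_mono) (auto simp: algebra_simps)
  also have "\<dots> \<le> exp (- 2 * (real n * \<gamma>)\<^sup>2 / real m)"
    by (rule prob_ge) (use assms in auto)
  also have "\<dots> \<le> exp (- 2 * real n * \<gamma>\<^sup>2)"
  proof -
    \<comment> \<open>Since \<open>m \<le> n\<close>, replacing the denominator \<open>m\<close> by
      \<open>n\<close> only weakens the bound.\<close>
    have "real m * (2 * real n * \<gamma>\<^sup>2) \<le> real n * (2 * real n * \<gamma>\<^sup>2)"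
      using assms by (intro mult_right_mono) auto
    then have "2 * real n * \<gamma>\<^sup>2 \<le> 2 * (real n * \<gamma>)\<^sup>2 / real m"
      using assms by (simp add: field_simps power2_eq_square)
    then show ?thesis by simp
  qed
  finally show ?thesis .
qed

lemma binomial_tail_le:
  assumes "p \<in> {0..1}" "0 < m" "0 \<le> \<gamma>"
  shows "measure_pmf.prob (binomial_pmf m p) {j. real j \<le> real m * (p - \<gamma>)} \<le> exp (- 2 * real m * \<gamma>\<^sup>2)"
proof -
  interpret binomial_distribution m p by unfold_locales (rule assms)
  have "measure_pmf.prob (binomial_pmf m p) {j. real j \<le> real m * (p - \<gamma>)}
      \<le> exp (- 2 * (real m * \<gamma>)\<^sup>2 / real m)"
    using prob_le[of "real m * \<gamma>"] assms by (simp add: algebra_simps)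
  also have "- 2 * (real m * \<gamma>)\<^sup>2 / real m = - 2 * real m * \<gamma>\<^sup>2"
    using assms by (simp add: power2_eq_square)
  finally show ?thesis .
qed

text \<open>
  Agents are drawn with replacement, so samples of a random profile are not independent. They are
  independent given the profile: one Hoeffding bound controls the profile, a second one the sample.
\<close>

definition resample :: "nat \<Rightarrow> nat \<Rightarrow> ('b \<Rightarrow> 'c) \<Rightarrow> (nat \<Rightarrow> 'b) pmf \<Rightarrow> 'c list pmf" where
  "resample n k g D = bind_pmf D (\<lambda>P. replicate_pmf k (map_pmf (\<lambda>i. g (P i)) (pmf_of_set {..<n})))"

text \<open>For a fixed profile the draws are independent, so the count is binomial with the
  frequency of \<open>x\<close> in the profile as parameter. The predicate \<open>R\<close> covers
  both tails.\<close>

lemma prob_count_resample: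
  assumes "0 < n"
  shows "measure_pmf.prob (replicate_pmf k (map_pmf f (pmf_of_set {..<n}))) {ys. R (count_list ys x)}
       = measure_pmf.prob (binomial_pmf k (real (card {i\<in>{..<n}. f i = x}) / real n)) {j. R j}"
proof -
  have ne: "{..<n} \<noteq> {}" using assms by auto
  have eq: "{..<n} \<inter> f -` {x} = {i\<in>{..<n}. f i = x}" by auto
  have "pmf (map_pmf f (pmf_of_set {..<n})) x = real (card {i\<in>{..<n}. f i = x}) / real n"
    unfolding pmf_map measure_pmf_of_set[OF ne finite_lessThan] eq by simp
  moreover have "measure_pmf.prob (replicate_pmf k (map_pmf f (pmf_of_set {..<n}))) {ys. R (count_list ys x)}
      = measure_pmf.prob (map_pmf (\<lambda>ys. count_list ys x) (replicate_pmf k (map_pmf f (pmf_of_set {..<n})))) {j. R j}"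
    by (simp only: measure_map_pmf vimage_def mem_Collect_eq)
  ultimately show ?thesis
    by (simp only: count_list_replicate_pmf)
qed

text \<open>\<open>B\<close> holds the random agents, and nobody else ever takes the value
  \<open>x\<close>. The profile frequency exceeds its mean bound \<open>q\<close> by \<gamma> with
  small probability, and the sample exceeds the profile by another \<gamma>.\<close>

lemma resample_count_ge:
  assumes B: "B \<subseteq> {..<n}" and p: "p \<in> {0..1}"
    and bern: "\<And>i. i \<in> B \<Longrightarrow> map_pmf (\<lambda>r. g r = x) (D i) = bernoulli_pmf p"
    and out: "\<And>P i. P \<in> set_pmf (Pi_pmf {..<n} d D) \<Longrightarrow> i \<in> {..<n} - B \<Longrightarrow> g (P i) \<noteq> x"
    and nk: "0 < n" "0 < k" and \<gamma>: "0 < \<gamma>" "real (card B) * p \<le> real n * q"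
  shows "measure_pmf.prob (resample n k g (Pi_pmf {..<n} d D))
           {ys. real (count_list ys x) \<ge> real k * (q + 2 * \<gamma>)}
         \<le> exp (- 2 * real n * \<gamma>\<^sup>2) + exp (- 2 * real k * \<gamma>\<^sup>2)"
proof -
  let ?c = "\<lambda>P. card {i\<in>{..<n}. g (P i) = x}" and ?cB = "\<lambda>P. card {i\<in>B. g (P i) = x}"
  let ?bad = "{P. real (?cB P) \<ge> real n * (q + \<gamma>)}"
  have q: "0 \<le> q" 
    using \<gamma>(2) nk(1) p by (metis atLeastAtMost_iff mult_nonneg_nonneg of_nat_0_le_iff of_nat_0_less_iff order_trans zero_le_mult_iff not_less)
  have cardB: "card B \<le> n" using card_mono[OF _ B] by simp
  have "measure_pmf.prob (resample n k g (Pi_pmf {..<n} d D))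
           {ys. real (count_list ys x) \<ge> real k * (q + 2 * \<gamma>)}
      \<le> measure_pmf.prob (Pi_pmf {..<n} d D) ?bad + exp (- 2 * real k * \<gamma>\<^sup>2)"
    unfolding resample_def
  proof (rule measure_bind_pmf_le)
    fix P assume P: "P \<in> set_pmf (Pi_pmf {..<n} d D)" "P \<notin> ?bad"
    have "{i\<in>{..<n}. g (P i) = x} = {i\<in>B. g (P i) = x}"
      using B out[OF P(1)] by auto
    then have "real (?c P) / real n \<le> q + \<gamma>"
      using P(2) nk by (simp add: field_simps)
    moreover have "?c P \<le> n" using card_mono[of "{..<n}" "{i\<in>{..<n}. g (P i) = x}"] by auto
    \<comment> \<open>The tail bound is applied with \<open>k\<close> both as number of coins and as
      scale, and with \<open>q + \<gamma>\<close> as bound on the mean.\<close>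
    ultimately have "measure_pmf.prob (binomial_pmf k (real (?c P) / real n))
         {j. real j \<ge> real k * ((q + \<gamma>) + \<gamma>)} \<le> exp (- 2 * real k * \<gamma>\<^sup>2)"
      using nk \<gamma> by (intro binomial_tail_ge mult_left_mono) auto
    then show "measure_pmf.prob (replicate_pmf k (map_pmf (\<lambda>i. g (P i)) (pmf_of_set {..<n})))
        {ys. real (count_list ys x) \<ge> real k * (q + 2 * \<gamma>)} \<le> exp (- 2 * real k * \<gamma>\<^sup>2)"
      by (subst prob_count_resample[OF nk(1)]) (simp add: algebra_simps)
  qed simp
  also have "measure_pmf.prob (Pi_pmf {..<n} d D) ?bad
      = measure_pmf.prob (binomial_pmf (card B) p) {j. real j \<ge> real n * (q + \<gamma>)}"
    by (subst card_Pi_pmf_binomial[where f="\<lambda>r. g r = x" and I="{..<n}" and D=D and d=d, symmetric])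
       (use B p bern in \<open>auto simp: vimage_def\<close>)
  also have "\<dots> \<le> exp (- 2 * real n * \<gamma>\<^sup>2)"
  \<comment> \<open>Hoeffding needs at least one coin. Without random agents the count is 0, below
    the positive threshold.\<close>
  proof (cases "card B = 0")
    case True
    have "0 < real n * (q + \<gamma>)" using nk \<gamma> q by simp
    then show ?thesis using True p by (simp add: binomial_pmf_0 indicator_def)
  next
    case False
    then show ?thesis using cardB \<gamma> p by (intro binomial_tail_ge) auto
  qed
  finally show ?thesis by simp
qed

lemma resample_count_le:
  assumes p: "p \<in> {0..1}"
    and bern: "\<And>i. i < n \<Longrightarrow> map_pmf (\<lambda>r. g r = x) (D i) = bernoulli_pmf p"
    and nk: "0 < n" "0 < k" and \<gamma>: "0 < \<gamma>"
  shows "measure_pmf.prob (resample n k g (Pi_pmf {..<n} d D))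
           {ys. real (count_list ys x) \<le> real k * (p - 2 * \<gamma>)}
         \<le> exp (- 2 * real n * \<gamma>\<^sup>2) + exp (- 2 * real k * \<gamma>\<^sup>2)"
proof -
  let ?c = "\<lambda>P. card {i\<in>{..<n}. g (P i) = x}"
  let ?bad = "{P. real (?c P) \<le> real n * (p - \<gamma>)}"
  have "measure_pmf.prob (resample n k g (Pi_pmf {..<n} d D))
           {ys. real (count_list ys x) \<le> real k * (p - 2 * \<gamma>)}
      \<le> measure_pmf.prob (Pi_pmf {..<n} d D) ?bad + exp (- 2 * real k * \<gamma>\<^sup>2)"
    unfolding resample_def
  proof (rule measure_bind_pmf_le)
    fix P assume P: "P \<notin> ?bad"
    have ge: "p - \<gamma> \<le> real (?c P) / real n"
      using P nk by (simp add: field_simps)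
    have "?c P \<le> n" using card_mono[of "{..<n}" "{i\<in>{..<n}. g (P i) = x}"] by auto
    \<comment> \<open>For a good profile the threshold is at most \<gamma> below the frequency in
      the profile, so the event shrinks into a Hoeffding tail.\<close>
    have "measure_pmf.prob (binomial_pmf k (real (?c P) / real n)) {j. real j \<le> real k * (p - 2 * \<gamma>)}
      \<le> measure_pmf.prob (binomial_pmf k (real (?c P) / real n)) {j. real j \<le> real k * (real (?c P) / real n - \<gamma>)}"
    proof (rule measure_pmf.finite_measure_mono)
      have "real k * (p - 2 * \<gamma>) \<le> real k * (real (?c P) / real n - \<gamma>)"
        using ge by (intro mult_left_mono) auto
      then show "{j. real j \<le> real k * (p - 2 * \<gamma>)} \<subseteq> {j. real j \<le> real k * (real (?c P) / real n - \<gamma>)}"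
        by auto
    qed simp
    also have "\<dots> \<le> exp (- 2 * real k * \<gamma>\<^sup>2)"
      using nk \<gamma> \<open>?c P \<le> n\<close> by (intro binomial_tail_le) auto
    finally show "measure_pmf.prob (replicate_pmf k (map_pmf (\<lambda>i. g (P i)) (pmf_of_set {..<n})))
        {ys. real (count_list ys x) \<le> real k * (p - 2 * \<gamma>)} \<le> exp (- 2 * real k * \<gamma>\<^sup>2)"
      by (subst prob_count_resample[OF nk(1)]) 
  qed simp
  also have "measure_pmf.prob (Pi_pmf {..<n} d D) ?bad
      = measure_pmf.prob (binomial_pmf (card {..<n}) p) {j. real j \<le> real n * (p - \<gamma>)}"
    by (subst card_Pi_pmf_binomial[where f="\<lambda>r. g r = x" and I="{..<n}" and D=D and d=d, symmetric])
       (use p bern in \<open>auto simp: vimage_def\<close>)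
  also have "\<dots> \<le> exp (- 2 * real n * \<gamma>\<^sup>2)"
    using binomial_tail_le[of p n \<gamma>] nk \<gamma> p by simp
  finally show ?thesis by simp
qed

section \<open>The tester\<close>

text \<open>The tree carries no state, so the answers obtained so far are stored in the continuation
  \<open>dec\<close>. The name of the drawn agent is ignored.\<close>

primrec sampler :: "'a \<Rightarrow> 'a \<Rightarrow> 'a \<Rightarrow> nat \<Rightarrow> ('a list \<Rightarrow> bool) \<Rightarrow> 'a algorithm" where
  "sampler a b c 0 dec = Output (dec [])"
| "sampler a b c (Suc k) dec = Draw (\<lambda>_. Compare a b (\<lambda>u.
     if u then Compare b c (\<lambda>v. sampler a b c k (\<lambda>ys. dec ((if v then c else b) # ys)))
     else Compare a c (\<lambda>v. sampler a b c k (\<lambda>ys. dec ((if v then c else a) # ys)))))"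

section \<open>Output distribution and cost of the sampler\<close>

lemma run_from_simps:
  "run_from n P r (Output x) = return_spmf x"
  "run_from n P r (Draw f) = bind_spmf (spmf_of_set {..<n}) (\<lambda>i. run_from n P (P i) (f i))"
  "run_from n P r (Compare x' y f') = run_from n P r (f' ((x', y) \<in> r))"
  by (subst run_from.simps, simp)+

text \<open>Both comparisons of a round address the same drawn agent and together compute
  \<open>worst_of\<close>. The induction generalizes \<open>r\<close>, which each draw replaces, and
  \<open>dec\<close>, which each round extends. All mass lies on \<open>Some\<close>: every run
  terminates.\<close>

lemma run_from_sampler:
  assumes "0 < n"
  shows "run_from n P r (sampler a b c k dec)
       = map_pmf (\<lambda>ys. Some (dec ys))
           (replicate_pmf k (map_pmf (\<lambda>i. worst_of a b c (P i)) (pmf_of_set {..<n})))"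
proof (induction k arbitrary: r dec)
  case (Suc k)
  let ?q = "map_pmf (\<lambda>i. worst_of a b c (P i)) (pmf_of_set {..<n})"
  have ne: "{..<n} \<noteq> {}" using assms by auto
  have "run_from n P r (sampler a b c (Suc k) dec)
      = bind_pmf (pmf_of_set {..<n}) (\<lambda>i. map_pmf (\<lambda>ys. Some (dec (worst_of a b c (P i) # ys))) (replicate_pmf k ?q))"
    by (auto simp: run_from_simps Suc worst_of_def spmf_of_set_def ne bind_spmf_of_pmf simp flip: spmf_of_pmf_pmf_of_set
             intro!: bind_pmf_cong)
  also have "\<dots> = map_pmf (\<lambda>ys. Some (dec ys)) (replicate_pmf (Suc k) ?q)"
    by (simp add: map_bind_pmf bind_map_pmf map_pmf_def bind_assoc_pmf bind_return_pmf)
  finally show ?case .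
qed (simp add: run_from_simps)

lemma error_prob_sampler:
  assumes "0 < n"
  shows "error_prob n D (sampler a b c k dec) v
       = measure_pmf.prob (resample n k (worst_of a b c) D) {ys. dec ys \<noteq> v}"
  unfolding error_prob_def run_def run_from_sampler[OF assms] resample_def
  by (simp flip: map_bind_pmf add: vimage_def)

inductive_cases can_compare_OutputE: "can_compare (Output v) q"
inductive_cases can_compare_DrawE: "can_compare (Draw f) q"
inductive_cases can_compare_CompareE: "can_compare (Compare x y f) q"

lemma can_compare_sampler:
  "can_compare (sampler a b c k dec) q \<Longrightarrow> q \<le> 2 * k"
proof (induction k arbitrary: dec q)
  case 0
  then show ?case by (auto elim: can_compare_OutputE)
next
  case (Suc k)
  \<comment> \<open>Bound after the first comparison of a round: one more comparison, then
    \<open>k\<close> rounds of two.\<close>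
  have step: "q' \<le> Suc (2 * k)"
    if "can_compare (Compare x y (\<lambda>v. sampler a b c k (dec' v))) q'" for x y dec' q'
    using that by (cases rule: can_compare_CompareE) (use Suc.IH in auto)
  from Suc.prems show ?case
    by (auto elim!: can_compare_DrawE can_compare_CompareE split: if_splits dest!: step)
qed

lemma sample_complexity_sampler: "sample_complexity (sampler a b c k dec) \<le> enat (2 * k)"
  unfolding sample_complexity_def by (rule SUP_least) (auto dest: can_compare_sampler)

section \<open>Constants\<close>

text \<open>As \<open>2 * 288 / 144 = 4\<close>, the bound is \<delta>^4, and \<delta>^3 < 1/8
  brings it below \<delta>/6. The sixth pays for three alternatives in two stages each.\<close>

lemma exp_error_bound:
  fixes \<delta> X :: real
  assumes \<delta>: "0 < \<delta>" "\<delta> < 1 / 2" and \<epsilon>: "\<epsilon> < 1"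
    and N: "288 * (1 / (1 - \<epsilon>)\<^sup>2 * ln (1 / \<delta>)) \<le> real N"
  shows "exp (- 2 * real N * ((1 - \<epsilon>) / 12)\<^sup>2) \<le> \<delta> / 6"
proof -
  have pos: "0 < (1 - \<epsilon>)\<^sup>2" using \<epsilon> by simp
  have "288 * ln (1 / \<delta>) \<le> real N * (1 - \<epsilon>)\<^sup>2"
    using N pos by (simp add: field_simps)
  then have "- 2 * real N * ((1 - \<epsilon>) / 12)\<^sup>2 \<le> 4 * ln \<delta>"
    using \<delta> by (simp add: ln_div power_divide)
  then have "exp (- 2 * real N * ((1 - \<epsilon>) / 12)\<^sup>2) \<le> exp (4 * ln \<delta>)" by simp
  also have "\<dots> = \<delta> ^ 4" using \<delta> exp_of_nat_mult[of 4 "ln \<delta>"] by simp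
  also have "\<dots> = \<delta> * \<delta> ^ 3" by (simp add: power_numeral_reduce)
  also have "\<dots> \<le> \<delta> * (1 / 2) ^ 3" using \<delta> by (intro mult_left_mono power_mono) auto
  also have "\<dots> \<le> \<delta> / 6" using \<delta> by (simp add: power_numeral_reduce)
  finally show ?thesis .
qed

text \<open>Lets a multiple of the ratio absorb the rounding of the number of rounds, and makes that
  number positive. It rests on \<open>ln \<delta> \<le> \<delta> - 1\<close>.\<close>

lemma ratio_ge_half:
  fixes \<delta> :: real
  assumes \<delta>: "0 < \<delta>" "\<delta> < 1 / 2" and \<epsilon>: "0 \<le> \<epsilon>" "\<epsilon> < 1"
  shows "1 / 2 \<le> 1 / (1 - \<epsilon>)\<^sup>2 * ln (1 / \<delta>)"
proof -
  have "1 / 2 \<le> - ln \<delta>" using ln_le_minus_one[of \<delta>] \<delta> by simp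
  then have L: "1 / 2 \<le> ln (1 / \<delta>)" using \<delta> by (simp add: ln_div)
  have "(1 - \<epsilon>)\<^sup>2 \<le> 1" using \<epsilon> by (simp add: power_le_one)
  then have "1 \<le> 1 / (1 - \<epsilon>)\<^sup>2" using \<epsilon> by simp
  from mult_mono[OF this L] show ?thesis using \<epsilon> by simp
qed

text \<open>The inequality is strict so that rejection means reaching the threshold, the event of
  \<open>resample_count_ge\<close>.\<close>

definition rare :: "'a list \<Rightarrow> real \<Rightarrow> 'a set \<Rightarrow> bool" where
  "rare ys \<theta> S \<longleftrightarrow> (\<exists>x\<in>S. real (count_list ys x) < real (length ys) * \<theta>)"

lemma length_resample: "ys \<in> set_pmf (resample n k g D) \<Longrightarrow> length ys = k"
  by (auto simp: resample_def set_replicate_pmf)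

text \<open>
  The last-place frequency is at most \<open>\<epsilon>/3 = 1/3 - 4\<gamma>\<close> in mean for the middle alternative of kind (i) and
  \<open>1/3\<close> for all three in kind (ii), so each of the two sampling stages may deviate by \<open>\<gamma>\<close> from its mean.
\<close>

lemma sampler_outliers_tester:
  fixes A :: "'a set" and \<epsilon> :: real
  defines "\<gamma> \<equiv> (1 - \<epsilon>) / 12"
  assumes A: "finite A" "{a, b, c} \<subseteq> A" and dist: "distinct [a, b, c]"
    and \<epsilon>: "0 \<le> \<epsilon>" "\<epsilon> < 1" and nk: "0 < n" "0 < k"
    and n: "exp (- 2 * real n * \<gamma>\<^sup>2) \<le> \<delta> / 6" and k: "exp (- 2 * real k * \<gamma>\<^sup>2) \<le> \<delta> / 6"
  shows "outliers_tester A n \<epsilon> \<delta>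
           (sampler a b c k (\<lambda>ys. rare ys (1 / 3 - 2 * \<gamma>) {a, b, c}))"
proof -
  let ?g = "worst_of a b c" and ?\<theta> = "1 / 3 - 2 * \<gamma>"
  let ?T = "sampler a b c k (\<lambda>ys. rare ys ?\<theta> {a, b, c})"
  have \<gamma>: "0 < \<gamma>" using \<epsilon> by (simp add: \<gamma>_def)
  have \<delta>: "0 \<le> \<delta>" using n exp_ge_zero[of "- 2 * real n * \<gamma>\<^sup>2"] by linarith
  have kind_ii: "error_prob n (random_profile A n) ?T False \<le> \<delta>"
  proof -
    let ?R = "resample n k ?g (random_profile A n)"
    let ?E = "\<lambda>x. {ys. real (count_list ys x) \<le> real k * ?\<theta>}"
    have E: "measure_pmf.prob ?R (?E x) \<le> \<delta> / 3" if "x \<in> {a, b, c}" for x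
      using resample_count_le[of "1 / 3" n ?g x "\<lambda>_. pmf_of_set (linear_orders A)" k "\<gamma>" "{}"]
        worst_of_uniform[OF A dist that] nk \<gamma> n k unfolding random_profile_def by simp
    have "error_prob n (random_profile A n) ?T False
        = measure_pmf.prob ?R {ys. rare ys ?\<theta> {a, b, c}}"
      by (simp add: error_prob_sampler[OF nk(1)])
    \<comment> \<open>The inclusion holds only on the support, where every sample has length
      \<open>k\<close>.\<close>
    also have "\<dots> \<le> measure_pmf.prob ?R (?E a \<union> ?E b \<union> ?E c)"
      by (intro measure_pmf.finite_measure_mono_AE) (auto simp: AE_measure_pmf_iff rare_def dest!: length_resample)
    also have "\<dots> \<le> measure_pmf.prob ?R (?E a) + measure_pmf.prob ?R (?E b) + measure_pmf.prob ?R (?E c)"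
      using measure_Un_le[of "?E a \<union> ?E b" ?R "?E c"] measure_Un_le[of "?E a" ?R "?E b"] by simp
    also have "\<dots> \<le> \<delta>" using E[of a] E[of b] E[of c] by simp
    finally show ?thesis .
  qed
  moreover have "error_prob n D ?T True \<le> \<delta>" if D: "random_outliers A n \<epsilon> D" for D
  proof -
    obtain W Q where W: "W \<subseteq> {..<n}" "real (card W) \<ge> (1 - \<epsilon>) * real n"
      and Q: "\<And>i. i \<in> W \<Longrightarrow> Q i \<in> linear_orders A" and sp: "single_peaked A W Q"
      and D_eq: "D = Pi_pmf {..<n} {}
            (\<lambda>i. if i \<in> W then return_pmf (Q i) else pmf_of_set (linear_orders A))"
      using D unfolding random_outliers_def by blast
    let ?D = "\<lambda>i. if i \<in> W then return_pmf (Q i) else pmf_of_set (linear_orders A)"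
    obtain v where v: "v \<in> {a, b, c}" "\<And>i. i \<in> W \<Longrightarrow> ?g (Q i) \<noteq> v"
      using single_peaked_never_worst[OF A dist Q sp] by blast
    have "card ({..<n} - W) = n - card W"
      using card_Diff_subset[of W "{..<n}"] W(1) finite_subset by auto
    moreover have "card W \<le> n" using card_mono[OF _ W(1)] by simp
    \<comment> \<open>At most \<epsilon> n agents are outliers, and each ranks \<open>v\<close> last
      with probability 1/3.\<close>
    ultimately have card: "real (card ({..<n} - W)) * (1 / 3) \<le> real n * (\<epsilon> / 3)"
      using W(2) by (simp add: algebra_simps of_nat_diff)
    have "error_prob n D ?T True = measure_pmf.prob (resample n k ?g D) {ys. \<not> rare ys ?\<theta> {a, b, c}}"
      by (simp add: error_prob_sampler[OF nk(1)])
    also have "\<dots> \<le> measure_pmf.prob (resample n k ?g D)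
         {ys. real (count_list ys v) \<ge> real k * (\<epsilon> / 3 + 2 * \<gamma>)}"
    proof (intro measure_pmf.finite_measure_mono_AE)
      \<comment> \<open>This is where \<gamma> comes from: two deviations above \<epsilon>/3 and two
        below 1/3 meet at the same threshold.\<close>
      have eq: "\<epsilon> / 3 + 2 * \<gamma> = ?\<theta>" by (simp add: \<gamma>_def field_simps)
      show "AE ys in resample n k ?g D. ys \<in> {ys. \<not> rare ys ?\<theta> {a, b, c}}
          \<longrightarrow> ys \<in> {ys. real (count_list ys v) \<ge> real k * (\<epsilon> / 3 + 2 * \<gamma>)}"
        unfolding eq using v(1) by (auto simp: AE_measure_pmf_iff rare_def not_less dest!: length_resample)
    qed simp
    also have "\<dots> \<le> exp (- 2 * real n * \<gamma>\<^sup>2) + exp (- 2 * real k * \<gamma>\<^sup>2)"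
      unfolding D_eq
    proof (rule resample_count_ge[where B="{..<n} - W" and p="1 / 3"])
      show "map_pmf (\<lambda>r. ?g r = v) (?D i) = bernoulli_pmf (1 / 3)" if "i \<in> {..<n} - W" for i
        using that worst_of_uniform[OF A dist v(1)] by simp
      show "?g (P i) \<noteq> v" if P: "P \<in> set_pmf (Pi_pmf {..<n} {} ?D)" and i: "i \<in> {..<n} - ({..<n} - W)" for P i
      proof -
        \<comment> \<open>For members of \<open>W\<close> the factor is a point mass, so
          \<open>P i = Q i\<close>.\<close>
        have "P i \<in> set_pmf (?D i)"
          using P i by (auto simp: set_Pi_pmf PiE_dflt_def)
        then show ?thesis using i v(2) by auto
      qed
    qed (use nk \<gamma> card in auto)
    also have "\<dots> \<le> \<delta>" using n k \<delta> by linarith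
    finally show ?thesis .
  qed
  ultimately show ?thesis unfolding outliers_tester_def by blast
qed

text \<open>Each profile in the support is an instance of kind (i) with \<open>W\<close> everyone.
  Averaging, output 1 is missed on the random profile with probability at most \<delta>, and so is
  output 0, although the two errors sum to at least 1.\<close>

lemma no_tester_card_2:
  assumes A: "finite A" "card A = 2" and \<epsilon>: "0 \<le> \<epsilon>" and \<delta>: "0 \<le> \<delta>" "\<delta> < 1 / 2"
  shows "\<not> outliers_tester A n \<epsilon> \<delta> T"
proof
  assume T: "outliers_tester A n \<epsilon> \<delta> T"
  let ?D = "random_profile A n"
  have "measure_pmf.prob (run n P T) {z. z \<noteq> Some True} \<le> \<delta>" if P: "P \<in> set_pmf ?D" for P
  proof -
    have PA: "P i \<in> linear_orders A" if "i < n" for i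
      using P that by (auto simp: random_profile_def set_Pi_pmf PiE_dflt_def
          set_pmf_of_set[OF linear_orders_nonempty finite_linear_orders[OF A(1)]])
    have P0: "P i = {}" if "\<not> i < n" for i
      using P that by (auto simp: random_profile_def set_Pi_pmf PiE_dflt_def)
    \<comment> \<open>A point mass is a product of point masses because \<open>P\<close> has the
      default value \<open>{}\<close> outside \<open>{..<n}\<close>.\<close>
    have "return_pmf P = Pi_pmf {..<n} {} (\<lambda>i. return_pmf (P i))"
      using P0 by (auto simp: fun_eq_iff)
    also have "\<dots> = Pi_pmf {..<n} {}
          (\<lambda>i. if i \<in> {..<n} then return_pmf (P i) else pmf_of_set (linear_orders A))"
      by (intro Pi_pmf_cong) auto
    finally have "random_outliers A n \<epsilon> (return_pmf P)"
      unfolding random_outliers_def using single_peaked_card_2[OF A(2), of "{..<n}" P] PA \<epsilon>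
      by (intro exI[of _ "{..<n}"] exI[of _ P]) (auto simp: algebra_simps)
    then have "error_prob n (return_pmf P) T True \<le> \<delta>"
      using T unfolding outliers_tester_def by blast
    then show ?thesis by (simp add: error_prob_def bind_return_pmf)
  qed
  then have "error_prob n ?D T True \<le> \<delta>"
    using measure_bind_pmf_le[of ?D "{}" "\<lambda>P. run n P T" "{z. z \<noteq> Some True}" \<delta>] \<delta>
    by (simp add: error_prob_def)
  moreover have "error_prob n ?D T False \<le> \<delta>"
    using T unfolding outliers_tester_def by blast
  moreover have "1 \<le> error_prob n ?D T True + error_prob n ?D T False"
  proof -
    \<comment> \<open>Nontermination counts as an error for both outputs, so the two events cover
      everything.\<close>
    have "{z. z \<noteq> Some True} \<union> {z. z \<noteq> Some False} = UNIV" by auto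
    then show ?thesis
      using measure_Un_le[of "{z. z \<noteq> Some True}" "bind_pmf ?D (\<lambda>P. run n P T)" "{z. z \<noteq> Some False}"]
      by (simp add: error_prob_def)
  qed
  ultimately show False using \<delta> by linarith
qed

text \<open>The tester is chosen before \<open>n\<close>, and one constant bounds both its cost and
  the least number of agents. Some lower bound on \<open>n\<close> is unavoidable: a single
  preference is always single peaked, so for \<open>n = 1\<close> a random profile is a mixture of
  instances of kind (i).\<close>

theorem theorem3p1:
  shows "(\<exists>C::real. C > 0 \<and>
      (\<forall>(A :: 'a set) (\<epsilon>::real) (\<delta>::real).
         finite A \<and> card A \<ge> 3 \<and> 0 \<le> \<epsilon> \<and> \<epsilon> < 1 \<and> 0 < \<delta> \<and> \<delta> < 1 / 2 \<longrightarrow>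
         (\<exists>T. ereal_of_enat (sample_complexity T) \<le> ereal (C * (1 / (1 - \<epsilon>)\<^sup>2 * ln (1 / \<delta>))) \<and>
              (\<forall>n. real n \<ge> C * (1 / (1 - \<epsilon>)\<^sup>2 * ln (1 / \<delta>)) \<longrightarrow> outliers_tester A n \<epsilon> \<delta> T))))
    \<and> (\<forall>(A :: 'a set) (n::nat) (\<epsilon>::real) (\<delta>::real).
         finite A \<and> card A = 2 \<and> n \<ge> 1 \<and> 0 \<le> \<epsilon> \<and> \<epsilon> < 1 \<and> 0 < \<delta> \<and> \<delta> < 1 / 2 \<longrightarrow>
         \<not> (\<exists>T. outliers_tester A n \<epsilon> \<delta> T))"
\<comment> \<open>Two comparisons in each of at most \<open>288 * X + 1\<close> rounds cost at most
  \<open>576 * X + 2\<close>, which is at most \<open>580 * X\<close> since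
  \<open>X \<ge> 1 / 2\<close>.\<close>
proof (intro conjI exI[of _ "580::real"] allI impI)
  fix A :: "'a set" and \<epsilon> \<delta> :: real
  assume H: "finite A \<and> card A \<ge> 3 \<and> 0 \<le> \<epsilon> \<and> \<epsilon> < 1 \<and> 0 < \<delta> \<and> \<delta> < 1 / 2"
  define X where "X = 1 / (1 - \<epsilon>)\<^sup>2 * ln (1 / \<delta>)"
  have X: "1 / 2 \<le> X" unfolding X_def using H by (intro ratio_ge_half) auto
  define k where "k = nat \<lceil>288 * X\<rceil>"
  have k: "288 * X \<le> real k" "real k \<le> 288 * X + 1" "0 < k"
    using X unfolding k_def by linarith+
  obtain B where B: "B \<subseteq> A" "card B = 3" using H obtain_subset_with_card_n by metis
  then obtain a b c where abc: "B = {a, b, c}" "distinct [a, b, c]"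
    by (auto simp: card_3_iff)
  let ?T = "sampler a b c k (\<lambda>ys. rare ys (1 / 3 - 2 * ((1 - \<epsilon>) / 12)) {a, b, c})"
  have "ereal_of_enat (sample_complexity ?T) \<le> ereal_of_enat (enat (2 * k))"
    using sample_complexity_sampler by (simp only: ereal_of_enat_le_iff)
  also have "\<dots> \<le> ereal (580 * X)" using k X by simp
  finally have "ereal_of_enat (sample_complexity ?T) \<le> ereal (580 * X)" .
  moreover have "outliers_tester A n \<epsilon> \<delta> ?T" if n: "580 * X \<le> real n" for n
  proof (rule sampler_outliers_tester)
    show "0 < n" using n X by (cases n) auto
    show "exp (- 2 * real n * ((1 - \<epsilon>) / 12)\<^sup>2) \<le> \<delta> / 6"
      using H n X by (intro exp_error_bound) (auto simp: X_def)
    show "exp (- 2 * real k * ((1 - \<epsilon>) / 12)\<^sup>2) \<le> \<delta> / 6"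
      using H k by (intro exp_error_bound) (auto simp: X_def)
  qed (use H B abc k in auto)
  ultimately show "\<exists>T. ereal_of_enat (sample_complexity T) \<le> ereal (580 * (1 / (1 - \<epsilon>)\<^sup>2 * ln (1 / \<delta>))) \<and>
              (\<forall>n. real n \<ge> 580 * (1 / (1 - \<epsilon>)\<^sup>2 * ln (1 / \<delta>)) \<longrightarrow> outliers_tester A n \<epsilon> \<delta> T)"
    unfolding X_def by blast
next
  fix A :: "'a set" and n :: nat and \<epsilon> \<delta> :: real
  assume "finite A \<and> card A = 2 \<and> n \<ge> 1 \<and> 0 \<le> \<epsilon> \<and> \<epsilon> < 1 \<and> 0 < \<delta> \<and> \<delta> < 1 / 2"
  then show "\<not> (\<exists>T. outliers_tester A n \<epsilon> \<delta> T)"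
    using no_tester_card_2[of A \<epsilon> \<delta> n] by auto
qed simp

end
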